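(* Let $T$ be a densely defined closed operator from $H_1$ to $H_2$. Then the following statements are equivalent: (1) $T$ is minimum attaining; (2) $|T|$ is minimum attaining (as an operator in $H_1$); (3) $T^*T$ is minimum attaining (as an operator in $H_1$).
   Context: $H_1,H_2$ are infinite dimensional complex Hilbert spaces. For a densely defined closed operator $T$ with domain $D(T)$, the minimum modulus is $m(T)=\inf\{\|Tx\|: x\in D(T),\ \|x\|=1\}$, and $T$ is minimum attaining if there is $x_0\in D(T)$ with $\|x_0\|=1$ and $\|Tx_0\|=m(T)$. $|T|=(T^*T)^{1/2}$ is the positive square root of the positive self-adjoint operator $T^*T$. *)

theory Defs
  imports "HOL-Analysis.Analysis"
begin

text \<open>
  Complex Hilbert spaces, on top of the real ones of the library: \<open>inner\<close> is the real part of the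
  complex inner product, so that norm and topology are those given by \<open>cinner\<close> and the
  positive definiteness of \<open>cinner\<close> is inherited from \<open>inner\<close>.
  The inner product is linear in its first argument.
\<close>

class complex_hilbert = real_inner + complete_space +
  fixes scaleC :: "complex \<Rightarrow> 'a \<Rightarrow> 'a"  (infixr "*\<^sub>C" 75)
    and cinner :: "'a \<Rightarrow> 'a \<Rightarrow> complex"
  assumes scaleC_add_right: "c *\<^sub>C (x + y) = c *\<^sub>C x + c *\<^sub>C y"
    and scaleC_add_left: "(c + d) *\<^sub>C x = c *\<^sub>C x + d *\<^sub>C x"
    and scaleC_scaleC: "c *\<^sub>C d *\<^sub>C x = (c * d) *\<^sub>C x"
    and scaleC_of_real: "of_real r *\<^sub>C x = r *\<^sub>R x"
    and cinner_commute: "cinner x y = cnj (cinner y x)"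
    and cinner_add_left: "cinner (x + y) z = cinner x z + cinner y z"
    and cinner_scaleC_left: "cinner (c *\<^sub>C x) y = c * cinner x y"
    and Re_cinner: "Re (cinner x y) = inner x y"

global_interpretation complex_vec: vector_space "scaleC :: complex \<Rightarrow> 'a \<Rightarrow> 'a::complex_hilbert"
  defines csubspace = complex_vec.subspace
    and cspan = complex_vec.span
proof
  fix x :: 'a
  show "1 *\<^sub>C x = x"
    using scaleC_of_real[of 1 x] by simp
qed (simp_all add: scaleC_add_right scaleC_add_left scaleC_scaleC)

lemma cinner_self: "cinner x x = of_real ((norm x)\<^sup>2)"
proof (rule complex_eqI)
  have "Im (cinner x x) = - Im (cinner x x)"
    using cinner_commute[of x x] by (metis cnj.simps(2))
  then show "Im (cinner x x) = Im (of_real ((norm x)\<^sup>2))"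
    by simp
qed (simp add: Re_cinner power2_norm_eq_inner)

definition cfinite_dim :: "'a::complex_hilbert itself \<Rightarrow> bool"
  where "cfinite_dim _ \<longleftrightarrow> (\<exists>B :: 'a set. finite B \<and> cspan B = UNIV)"

text \<open>
  A not necessarily everywhere defined operator is a partial function \<open>T :: 'a \<rightharpoonup> 'b\<close> with domain
  \<open>dom T\<close>. Equality of partial functions includes equality of domains, and \<open>S \<circ>\<^sub>m T\<close> is the product
  with its maximal domain, consisting of the \<open>x \<in> dom T\<close> with \<open>T x \<in> dom S\<close>.
\<close>

definition linear_op :: "('a::complex_hilbert \<rightharpoonup> 'b::complex_hilbert) \<Rightarrow> bool"
  where "linear_op T \<longleftrightarrow> csubspace (dom T) \<and>
    (\<forall>x\<in>dom T. \<forall>y\<in>dom T. the (T (x + y)) = the (T x) + the (T y)) \<and>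
    (\<forall>c. \<forall>x\<in>dom T. the (T (c *\<^sub>C x)) = c *\<^sub>C the (T x))"

definition densely_defined :: "('a::complex_hilbert \<rightharpoonup> 'b::complex_hilbert) \<Rightarrow> bool"
  where "densely_defined T \<longleftrightarrow> closure (dom T) = UNIV"

definition closed_op :: "('a::complex_hilbert \<rightharpoonup> 'b::complex_hilbert) \<Rightarrow> bool"
  where "closed_op T \<longleftrightarrow> linear_op T \<and> closed (Map.graph T)"

text \<open>The description below determines \<open>z\<close> uniquely if \<open>T\<close> is densely defined.\<close>

definition adjoint_op :: "('a::complex_hilbert \<rightharpoonup> 'b::complex_hilbert) \<Rightarrow> ('b \<rightharpoonup> 'a)"
  where "adjoint_op T y =
    (if \<exists>z. \<forall>x\<in>dom T. cinner (the (T x)) y = cinner x z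
     then Some (THE z. \<forall>x\<in>dom T. cinner (the (T x)) y = cinner x z)
     else None)"

definition selfadjoint_op :: "('a::complex_hilbert \<rightharpoonup> 'a) \<Rightarrow> bool"
  where "selfadjoint_op A \<longleftrightarrow> linear_op A \<and> densely_defined A \<and> adjoint_op A = A"

definition positive_op :: "('a::complex_hilbert \<rightharpoonup> 'a) \<Rightarrow> bool"
  where "positive_op A \<longleftrightarrow> (\<forall>x\<in>dom A. cinner (the (A x)) x \<in> \<real>\<^sub>\<ge>\<^sub>0)"

definition sqrt_op :: "('a::complex_hilbert \<rightharpoonup> 'a) \<Rightarrow> ('a \<rightharpoonup> 'a)"
  where "sqrt_op A = (THE S. selfadjoint_op S \<and> positive_op S \<and> S \<circ>\<^sub>m S = A)"

definition abs_op :: "('a::complex_hilbert \<rightharpoonup> 'b::complex_hilbert) \<Rightarrow> ('a \<rightharpoonup> 'a)"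
  where "abs_op T = sqrt_op (adjoint_op T \<circ>\<^sub>m T)"

definition min_modulus :: "('a::complex_hilbert \<rightharpoonup> 'b::complex_hilbert) \<Rightarrow> real"
  where "min_modulus T = Inf {norm (the (T x)) | x. x \<in> dom T \<and> norm x = 1}"

definition min_attaining :: "('a::complex_hilbert \<rightharpoonup> 'b::complex_hilbert) \<Rightarrow> bool"
  where "min_attaining T \<longleftrightarrow>
    (\<exists>x\<^sub>0\<in>dom T. norm x\<^sub>0 = 1 \<and> norm (the (T x\<^sub>0)) = min_modulus T)"

end

theory Submission
  imports Defs
begin

text \<open>
  For closed densely defined \<open>T\<close>, projecting \<open>(h, 0)\<close> onto the graph of \<open>T\<close> yields the bounded
  resolvent \<open>R = (1 + A)\<^sup>-\<^sup>1\<close> of \<open>A = T\<^sup>* T\<close>, with \<open>0 \<le> R \<le> 1\<close> and \<open>R\<close> injective. Its bounded square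
  roots \<open>Q = R\<^sup>1\<^sup>/\<^sup>2\<close> and \<open>P = (1 - R)\<^sup>1\<^sup>/\<^sup>2\<close> give the positive self-adjoint root \<open>P Q\<^sup>-\<^sup>1\<close> of \<open>A\<close>,
  and it is the only one, so \<open>|T|\<close> is a closed operator with \<open>|T|\<^sup>* |T| = A\<close>. It thus suffices that
  \<open>T\<close> attains its minimum iff \<open>T\<^sup>* T\<close> does. If \<open>T\<close> attains its minimum \<open>m\<close> at \<open>x\<^sub>0\<close>, the vanishing
  derivative of \<open>\<parallel>T x\<parallel>\<^sup>2 - m\<^sup>2 \<parallel>x\<parallel>\<^sup>2\<close> at \<open>x\<^sub>0\<close> gives \<open>A x\<^sub>0 = m\<^sup>2 x\<^sub>0\<close>. Conversely, if \<open>A\<close> attains its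
  minimum \<open>\<mu>\<close> at \<open>x\<^sub>0\<close>, then \<open>A x\<^sub>0 = \<mu> x\<^sub>0\<close> and \<open>A \<ge> \<mu>\<close>, which extends from the core \<open>D(A)\<close> to
  \<open>\<parallel>T x\<parallel>\<^sup>2 \<ge> \<mu> \<parallel>x\<parallel>\<^sup>2\<close> on \<open>D(T)\<close>.
\<close>

subsection \<open>Projections and bounded square roots in real Hilbert spaces\<close>

instance complex_hilbert \<subseteq> banach ..

text \<open>Near \<open>t = 0\<close> a nonzero linear term would dominate and change sign. This is
  the first-order condition behind the variational arguments below.\<close>

lemma linear_coeff_zero:
  fixes a b :: real
  assumes "\<And>t. 0 \<le> 2 * t * a + t\<^sup>2 * b"
  shows "a = 0"
proof (rule ccontr)
  assume a: "a \<noteq> 0"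
  \<comment> \<open>Any positive \<open>c\<close> above \<open>b / 2\<close> makes the polynomial
    negative at \<open>t = - a / c\<close>; \<open>b\<close> may have either sign.\<close>
  define c where "c = \<bar>b\<bar> + 1"
  have c: "c > 0" "b < c" by (auto simp: c_def)
  have "2 * (- a / c) * a + (- a / c)\<^sup>2 * b = (a\<^sup>2 / c) * (b / c - 2)"
    using c by (simp add: field_simps power2_eq_square)
  moreover have "(a\<^sup>2 / c) * (b / c - 2) < 0"
    using a c by (intro mult_pos_neg) (auto simp: field_simps)
  ultimately show False
    using assms[of "- a / c"] by linarith
qed

text \<open>A minimizing sequence for the distance from \<open>x\<close> is Cauchy, and its limit is
  a nearest point of \<open>S\<close>.\<close>

lemma orthogonal_projection_exists:
  fixes S :: "'a::{real_inner,banach} set"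
  assumes "closed S" "subspace S"
  obtains y where "y \<in> S" "\<And>z. z \<in> S \<Longrightarrow> inner (x - y) z = 0"
proof -
  define d where "d = infdist x S"
  have ne: "S \<noteq> {}" using assms(2) subspace_0 by blast
  have dle: "d \<le> norm (x - s)" if "s \<in> S" for s
    using infdist_le[OF that, of x] by (simp add: d_def dist_norm)
  have d0: "d \<ge> 0" by (simp add: d_def infdist_nonneg)
  have "\<exists>s\<in>S. norm (x - s) < d + 1 / real (Suc n)" for n
    using cInf_lessD[of "(\<lambda>a. dist x a) ` S" "d + 1 / real (Suc n)"] ne
    by (auto simp: d_def infdist_def dist_norm)
  then obtain y where yS: "\<And>n. y n \<in> S" and yd: "\<And>n. norm (x - y n) < d + 1 / real (Suc n)"
    by metis
  \<comment> \<open>Parallelogram law: the midpoint of \<open>y m\<close> and \<open>y n\<close>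
    lies in \<open>S\<close>, hence has distance at least \<open>d\<close> from
    \<open>x\<close>.\<close>
  have par: "(norm (y m - y n))\<^sup>2 \<le> 2 * (norm (x - y m))\<^sup>2 + 2 * (norm (x - y n))\<^sup>2 - 4 * d\<^sup>2" for m n
  proof -
    have "(1/2) *\<^sub>R (y m + y n) \<in> S"
      using assms(2) yS by (intro subspace_scale subspace_add)
    from dle[OF this] have "d\<^sup>2 \<le> (norm (x - (1/2) *\<^sub>R (y m + y n)))\<^sup>2"
      using d0 by (intro power_mono)
    then show ?thesis
      by (simp add: power2_norm_eq_inner inner_simps inner_commute algebra_simps)
  qed
  have lim: "(\<lambda>n. norm (x - y n)) \<longlonglongrightarrow> d"
  proof (rule tendsto_sandwich)
    show "(\<lambda>n. d) \<longlonglongrightarrow> d" by simp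
    have "(\<lambda>n. d + 1 / real (Suc n)) \<longlonglongrightarrow> d + 0"
      by (intro tendsto_add tendsto_const LIMSEQ_Suc lim_1_over_n)
    then show "(\<lambda>n. d + 1 / real (Suc n)) \<longlonglongrightarrow> d" by simp
  qed (use dle yS yd in \<open>auto intro!: always_eventually less_imp_le\<close>)
  have "Cauchy y"
  proof (rule metric_CauchyI)
    fix e :: real assume e: "e > 0"
    have "(\<lambda>n. (norm (x - y n))\<^sup>2) \<longlonglongrightarrow> d\<^sup>2"
      using lim by (intro tendsto_power)
    then have "\<forall>\<^sub>F n in sequentially. (norm (x - y n))\<^sup>2 < d\<^sup>2 + e\<^sup>2 / 4"
      using e by (intro order_tendstoD) auto
    then obtain N where N: "\<And>n. n \<ge> N \<Longrightarrow> (norm (x - y n))\<^sup>2 < d\<^sup>2 + e\<^sup>2 / 4"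
      by (auto simp: eventually_sequentially)
    have "dist (y m) (y n) < e" if "m \<ge> N" "n \<ge> N" for m n
    proof -
      have "(norm (y m - y n))\<^sup>2 < e\<^sup>2"
        using par[of m n] N[OF that(1)] N[OF that(2)] by linarith
      then show ?thesis
        using e by (metis dist_norm less_imp_le power2_less_imp_less)
    qed
    then show "\<exists>N. \<forall>m\<ge>N. \<forall>n\<ge>N. dist (y m) (y n) < e" by blast
  qed
  then obtain l where l: "y \<longlonglongrightarrow> l"
    using Cauchy_convergent convergentD by blast
  have lS: "l \<in> S"
    using assms(1) yS l by (rule closed_sequentially)
  have ld: "norm (x - l) = d"
    using LIMSEQ_unique[OF lim tendsto_norm[OF tendsto_diff[OF tendsto_const l]]] by simp
  have "inner (x - l) z = 0" if z: "z \<in> S" for z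
  proof -
    \<comment> \<open>Moving from the nearest point \<open>l\<close> along \<open>z\<close> cannot
      decrease the squared distance to \<open>x\<close>.\<close>
    have "0 \<le> 2 * t * (- inner (x - l) z) + t\<^sup>2 * (norm z)\<^sup>2" for t
    proof -
      have "l + t *\<^sub>R z \<in> S"
        using assms(2) z lS by (intro subspace_scale subspace_add)
      from dle[OF this] have "(norm (x - l))\<^sup>2 \<le> (norm (x - (l + t *\<^sub>R z)))\<^sup>2"
        using ld by (intro power_mono) auto
      then show ?thesis
        by (simp add: power2_norm_eq_inner inner_simps inner_commute algebra_simps power2_eq_square[of t])
    qed
    then show ?thesis using linear_coeff_zero by fastforce
  qed
  with lS that show ?thesis by blast
qed

lemma subspace_closure:
  fixes S :: "'a::real_normed_vector set"
  assumes "subspace S"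
  shows "subspace (closure S)"
proof (rule subspaceI)
  show "0 \<in> closure S"
    using assms closure_subset subspace_0 by blast
  show "x + y \<in> closure S" if xy: "x \<in> closure S" "y \<in> closure S" for x y
  proof -
    obtain f g where "\<And>n. f n \<in> S" "f \<longlonglongrightarrow> x" "\<And>n. g n \<in> S" "g \<longlonglongrightarrow> y"
      using xy unfolding closure_sequential by metis
    then have "\<forall>n. f n + g n \<in> S" "(\<lambda>n. f n + g n) \<longlonglongrightarrow> x + y"
      by (auto intro: tendsto_add subspace_add[OF assms])
    then show ?thesis
      unfolding closure_sequential by (intro exI[of _ "\<lambda>n. f n + g n"] conjI)
  qed
  show "c *\<^sub>R x \<in> closure S" if x: "x \<in> closure S" for c x
  proof -
    obtain f where "\<And>n. f n \<in> S" "f \<longlonglongrightarrow> x"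
      using x unfolding closure_sequential by metis
    then have "\<forall>n. c *\<^sub>R f n \<in> S" "(\<lambda>n. c *\<^sub>R f n) \<longlonglongrightarrow> c *\<^sub>R x"
      by (auto intro: tendsto_scaleR subspace_scale[OF assms])
    then show ?thesis
      unfolding closure_sequential by (intro exI[of _ "\<lambda>n. c *\<^sub>R f n"] conjI)
  qed
qed

text \<open>The difference between \<open>x\<close> and its projection onto \<open>closure S\<close>
  is orthogonal to \<open>S\<close>.\<close>

lemma dense_if_orthogonal_trivial:
  fixes S :: "'a::{real_inner,banach} set"
  assumes "subspace S" and triv: "\<And>x. (\<And>z. z \<in> S \<Longrightarrow> inner x z = 0) \<Longrightarrow> x = 0"
  shows "closure S = UNIV"
proof -
  have "x \<in> closure S" for x
  proof -
    obtain y where y: "y \<in> closure S" "\<And>z. z \<in> closure S \<Longrightarrow> inner (x - y) z = 0"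
      using orthogonal_projection_exists[of "closure S" x] assms(1) subspace_closure
      by (metis closed_closure)
    have "x - y = 0"
      using y(2) closure_subset by (intro triv) blast
    with y(1) show ?thesis by simp
  qed
  then show ?thesis by blast
qed

lemma orthogonal_to_dense:
  fixes S :: "'a::real_inner set"
  assumes "closure S = UNIV" "\<And>z. z \<in> S \<Longrightarrow> inner x z = 0"
  shows "x = 0"
proof -
  have "closed {z. inner x z = 0}"
    by (intro closed_Collect_eq continuous_intros)
  then have "closure S \<subseteq> {z. inner x z = 0}"
    using assms(2) by (intro closure_minimal) auto
  with assms(1) have "inner x x = 0" by blast
  then show ?thesis by simp
qed

section \<open>Symmetric maps and square roots of bounded positive operators\<close>

definition symmetric_map :: "('a::real_inner \<Rightarrow> 'a) \<Rightarrow> bool"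
  where "symmetric_map f \<longleftrightarrow> (\<forall>x y. inner (f x) y = inner x (f y))"

lemma symmetric_mapD: "symmetric_map f \<Longrightarrow> inner (f x) y = inner x (f y)"
  by (simp add: symmetric_map_def)

text \<open>Along \<open>x + t *\<^sub>R f x\<close> the nonnegative form has no constant term, and
  its linear coefficient is twice the square of \<open>norm (f x)\<close>.\<close>

lemma positive_map_null:
  assumes "linear f" "symmetric_map f" and pos: "\<And>x. 0 \<le> inner (f x) x"
    and null: "inner (f x) x = 0"
  shows "f x = 0"
proof -
  have "0 \<le> 2 * t * (norm (f x))\<^sup>2 + t\<^sup>2 * inner (f (f x)) (f x)" for t
    using pos[of "x + t *\<^sub>R f x"] null symmetric_mapD[OF assms(2), of "f x" x]
    by (simp add: linear_add[OF assms(1)] linear_scale[OF assms(1)] inner_simps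
        power2_norm_eq_inner power2_eq_square[of t] algebra_simps)
  then show ?thesis using linear_coeff_zero by fastforce
qed

text \<open>By commutation, \<open>f + g\<close> annihilates \<open>y = f x - g x\<close>. Both
  nonnegative forms therefore vanish at \<open>y\<close>, so \<open>f\<close> and \<open>g\<close>
  do too, and symmetry gives \<open>inner y y = 0\<close>.\<close>

lemma positive_root_unique:
  assumes f: "linear f" "symmetric_map f" "\<And>x. 0 \<le> inner (f x) x"
    and g: "linear g" "symmetric_map g" "\<And>x. 0 \<le> inner (g x) x"
    and comm: "\<And>x. f (g x) = g (f x)" and sq: "\<And>x. f (f x) = g (g x)"
  shows "f x = g x"
proof -
  define y where "y = f x - g x"
  have "f y + g y = 0"
    by (simp add: y_def linear_diff[OF f(1)] linear_diff[OF g(1)] comm sq)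
  then have "inner (f y) y + inner (g y) y = 0"
    by (metis inner_add_left inner_zero_left)
  with f(3)[of y] g(3)[of y] have "inner (f y) y = 0" "inner (g y) y = 0" by linarith+
  then have "f y = 0" "g y = 0"
    using positive_map_null f g by blast+
  moreover have "inner y y = inner (f y) x - inner (g y) x"
    using symmetric_mapD[OF f(2)] symmetric_mapD[OF g(2)]
    by (metis inner_commute inner_diff_right y_def)
  ultimately have "y = 0" by simp
  then show ?thesis by (simp add: y_def)
qed

text \<open>
  The root is \<open>1 - Y\<close>, where \<open>Y = (X + Y\<^sup>2) / 2\<close> for \<open>X = 1 - B\<close>. The fixed-point iteration for \<open>Y\<close>
  converges in operator norm because its increments are dominated by those of the scalar iteration
  \<open>y = (1 + y\<^sup>2) / 2\<close>, which increases and is bounded by \<open>1\<close>.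
\<close>

lemma blinfun_sqrt:
  fixes B :: "'a::{real_inner,banach} \<Rightarrow>\<^sub>L 'a"
  assumes nB: "norm (id_blinfun - B) \<le> 1" and symB: "symmetric_map B"
  obtains C :: "'a \<Rightarrow>\<^sub>L 'a" where "\<And>x. C (C x) = B x" "symmetric_map C" "\<And>x. 0 \<le> inner (C x) x"
    "norm (id_blinfun - C) \<le> 1"
    "\<And>f x. bounded_linear f \<Longrightarrow> (\<And>x. f (B x) = B (f x)) \<Longrightarrow> f (C x) = C (f x)"
proof -
  define X where "X = id_blinfun - B"
  define Y where "Y = rec_nat 0 (\<lambda>_ Y. (1/2) *\<^sub>R (X + (Y o\<^sub>L Y)))"
  define y :: "nat \<Rightarrow> real" where "y = rec_nat 0 (\<lambda>_ y. (1/2) * (1 + y * y))"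
  have Y0: "Y 0 = 0" and YS: "\<And>n. Y (Suc n) = (1/2) *\<^sub>R (X + (Y n o\<^sub>L Y n))"
    by (simp_all add: Y_def)
  have y0: "y 0 = 0" and yS: "\<And>n. y (Suc n) = (1/2) * (1 + y n * y n)"
    by (simp_all add: y_def)
  have nX: "norm X \<le> 1" using nB by (simp add: X_def)
  have y01: "0 \<le> y n \<and> y n \<le> 1" for n
  proof (induction n)
    case (Suc n)
    then have "y n * y n \<le> 1" by (simp add: mult_le_one)
    with Suc show ?case by (simp add: yS)
  qed (simp add: y0)
  have nY: "norm (Y n) \<le> y n" for n
  proof (induction n)
    case (Suc n)
    have "norm (Y n o\<^sub>L Y n) \<le> y n * y n"
      using norm_blinfun_compose[of "Y n" "Y n"] mult_mono[OF Suc Suc] y01[of n] by force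
    then show ?case
      using nX norm_triangle_ineq[of X "Y n o\<^sub>L Y n"] by (simp add: YS yS)
  qed (simp add: Y0 y0)
  have step: "norm (Y (Suc n) - Y n) \<le> y (Suc n) - y n" for n
  proof (induction n)
    case 0
    show ?case using nY[of "Suc 0"] by (simp add: Y0 y0)
  next
    case (Suc n)
    let ?D = "Y (Suc n) - Y n" and ?d = "y (Suc n) - y n"
    \<comment> \<open>The difference of two squares is split with the factors kept in order, so the
      iterates need not be shown to commute.\<close>
    have eq: "Y (Suc (Suc n)) - Y (Suc n) = (1/2) *\<^sub>R ((Y (Suc n) o\<^sub>L ?D) + (?D o\<^sub>L Y n))"
      unfolding YS[of "Suc n"]
      by (subst (3) YS, rule blinfun_eqI)
        (simp add: blinfun.bilinear_simps algebra_simps)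
    have "norm (Y (Suc n) o\<^sub>L ?D) \<le> y (Suc n) * ?d"
      using norm_blinfun_compose[of "Y (Suc n)" ?D] mult_mono[OF nY[of "Suc n"] Suc] y01[of "Suc n"]
      by force
    moreover have "norm (?D o\<^sub>L Y n) \<le> ?d * y n"
      using norm_blinfun_compose[of ?D "Y n"] mult_mono[OF Suc nY[of n]] norm_ge_zero[of ?D] norm_ge_zero[of "Y n"] Suc
      by (smt (verit))
    ultimately have "norm ((Y (Suc n) o\<^sub>L ?D) + (?D o\<^sub>L Y n)) \<le> y (Suc n) * ?d + ?d * y n"
      using norm_triangle_le by (metis add_mono)
    moreover have "y (Suc n) * ?d + ?d * y n = 2 * (y (Suc (Suc n)) - y (Suc n))"
      using yS[of "Suc n"] yS[of n] by (simp add: algebra_simps)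
    ultimately show ?case
      unfolding eq by simp
  qed
  have mono: "y n \<le> y (Suc n)" for n
    using step[of n] norm_ge_zero[of "Y (Suc n) - Y n"] by linarith
  have "summable (\<lambda>n. y (Suc n) - y n)"
  proof (rule telescope_summable)
    have "convergent y"
      using incseq_SucI[of y] mono y01
      by (intro Bseq_mono_convergent BseqI'[of _ 1]) (auto dest: incseqD)
    then show "y \<longlonglongrightarrow> lim y" by (simp add: convergent_LIMSEQ_iff)
  qed
  then have "summable (\<lambda>n. Y (Suc n) - Y n)"
    by (rule summable_comparison_test'[where N = 0]) (rule step)
  then obtain s where "(\<lambda>n. \<Sum>i<n. Y (Suc i) - Y i) \<longlonglongrightarrow> s"
    by (auto simp: summable_def sums_def)
  then have lim: "Y \<longlonglongrightarrow> s"
    by (simp add: sum_lessThan_telescope Y0)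
  have limx: "(\<lambda>n. Y n x) \<longlonglongrightarrow> s x" for x
    by (intro blinfun.tendsto tendsto_const lim)
  have fix_s: "s x = (1/2) *\<^sub>R (X x + s (s x))" for x
  proof -
    have "(\<lambda>n. Y n (Y n x)) \<longlonglongrightarrow> s (s x)"
      by (intro blinfun.tendsto tendsto_const lim)
    then have "(\<lambda>n. Y (Suc n) x) \<longlonglongrightarrow> (1/2) *\<^sub>R (X x + s (s x))"
      by (auto simp: YS blinfun.bilinear_simps intro!: tendsto_add tendsto_scaleR)
    then show ?thesis
      using LIMSEQ_unique LIMSEQ_Suc[OF limx[of x]] by blast
  qed
  have ns: "norm s \<le> 1"
    using lim nY y01 by (intro LIMSEQ_le_const2[OF tendsto_norm[OF lim]]) (meson order_trans)
  have symX: "inner (X x) z = inner x (X z)" for x z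
    using symB by (simp add: X_def blinfun.bilinear_simps inner_simps symmetric_map_def)
  have symY: "inner (Y n x) z = inner x (Y n z)" for n x z
    by (induction n arbitrary: x z)
      (simp_all add: Y0 YS blinfun.bilinear_simps inner_simps symX)
  have syms: "inner (s x) z = inner x (s z)" for x z
  proof (rule LIMSEQ_unique)
    show "(\<lambda>n. inner (Y n x) z) \<longlonglongrightarrow> inner (s x) z"
      by (intro tendsto_inner limx tendsto_const)
    show "(\<lambda>n. inner (Y n x) z) \<longlonglongrightarrow> inner x (s z)"
      unfolding symY by (intro tendsto_inner limx tendsto_const)
  qed
  have comm: "f (s x) = s (f x)" if f: "bounded_linear f" "\<And>x. f (B x) = B (f x)" for f x
  proof -
    interpret f: bounded_linear f by fact
    \<comment> \<open>Each iterate is a polynomial in \<open>B\<close>; continuity of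
      \<open>f\<close> carries the commutation to the limit.\<close>
    have "f (Y n x) = Y n (f x)" for n x
      by (induction n arbitrary: x)
        (simp_all add: Y0 YS X_def blinfun.bilinear_simps f.add f.scaleR f.zero f.diff f(2))
    then show ?thesis
      using LIMSEQ_unique[OF f.tendsto[OF limx[of x]]] limx by simp
  qed
  show thesis
  proof (rule that[of "id_blinfun - s"])
    show "(id_blinfun - s) ((id_blinfun - s) x) = B x" for x
    proof -
      \<comment> \<open>The fixed-point equation says \<open>2 s = X + s s\<close>, which is
        \<open>(1 - s)(1 - s) = 1 - X = B\<close>.\<close>
      have "2 *\<^sub>R s x = X x + s (s x)" by (subst fix_s) simp
      then show ?thesis by (simp add: blinfun.bilinear_simps X_def scaleR_2 algebra_simps)
    qed
    show "symmetric_map (id_blinfun - s)"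
      by (simp add: symmetric_map_def blinfun.bilinear_simps inner_simps syms)
    show "0 \<le> inner ((id_blinfun - s) x) x" for x
    proof -
      have "inner (s x) x \<le> norm (s x) * norm x"
        by (rule norm_cauchy_schwarz)
      also have "\<dots> \<le> norm x * norm x"
        using norm_blinfun[of s x] mult_right_mono[OF ns norm_ge_zero[of x]]
        by (intro mult_right_mono) auto
      finally show ?thesis
        by (simp add: blinfun.bilinear_simps inner_simps power2_norm_eq_inner[symmetric] power2_eq_square)
    qed
    show "norm (id_blinfun - (id_blinfun - s)) \<le> 1" using ns by simp
    show "f ((id_blinfun - s) x) = (id_blinfun - s) (f x)"
      if "bounded_linear f" "\<And>x. f (B x) = B (f x)" for f x
      using comm[OF that] by (simp add: blinfun.bilinear_simps bounded_linear.linear linear_diff that(1))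
  qed
qed

text \<open>The root \<open>C\<close> of \<open>D\<close> commutes with \<open>f\<close>, so the
  form of \<open>f D\<close> at \<open>x\<close> is the form of \<open>f\<close> at
  \<open>C x\<close>.\<close>

lemma positive_commuting_compose:
  fixes D :: "'a::{real_inner,banach} \<Rightarrow>\<^sub>L 'a"
  assumes "bounded_linear f" "\<And>x. 0 \<le> inner (f x) x"
    and "norm (id_blinfun - D) \<le> 1" "symmetric_map D" and "\<And>x. f (D x) = D (f x)"
  shows "0 \<le> inner (f (D x)) x"
proof -
  obtain C where C: "\<And>x. C (C x) = D x" "symmetric_map C"
    and comm: "\<And>f x. bounded_linear f \<Longrightarrow> (\<And>x. f (D x) = D (f x)) \<Longrightarrow> f (C x) = C (f x)"
    using blinfun_sqrt[OF assms(3,4)] by (metis (no_types, lifting))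
  have "inner (f (D x)) x = inner (f (C x)) (C x)"
    using comm[OF assms(1,5)] symmetric_mapD[OF C(2)] by (metis C(1))
  then show ?thesis using assms(2) by simp
qed

subsection \<open>Adjoints of partial operators\<close>

text \<open>The real inner product thus determines the complex one: an identity of real inner
  products gives the complex identity once it also holds with the first argument multiplied by
  \<open>- \<i>\<close>.\<close>

lemma Im_cinner: "Im (cinner x y) = inner ((- \<i>) *\<^sub>C x) y"
proof -
  have "inner ((- \<i>) *\<^sub>C x) y = Re ((- \<i>) * cinner x y)"
    by (simp only: Re_cinner[symmetric] cinner_scaleC_left)
  then show ?thesis by simp
qed

lemma inner_scaleC_left: "inner (c *\<^sub>C x) y = inner x (cnj c *\<^sub>C y)"
proof -
  have "cinner x (cnj c *\<^sub>C y) = cnj (cinner (cnj c *\<^sub>C y) x)"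
    by (rule cinner_commute)
  also have "\<dots> = cinner (c *\<^sub>C x) y"
    by (simp add: cinner_scaleC_left cinner_commute[of x y])
  finally have "cinner x (cnj c *\<^sub>C y) = cinner (c *\<^sub>C x) y" .
  then show ?thesis by (metis Re_cinner)
qed

lemma norm_scaleC: "norm (c *\<^sub>C x) = cmod c * norm x"
proof -
  have "(norm (c *\<^sub>C x))\<^sup>2 = inner x ((cnj c * c) *\<^sub>C x)"
    by (simp add: power2_norm_eq_inner inner_scaleC_left scaleC_scaleC)
  also have "\<dots> = (cmod c * norm x)\<^sup>2"
    by (metis complex_norm_square inner_scaleR_right mult.commute power2_norm_eq_inner
        power_mult_distrib scaleC_of_real)
  finally show ?thesis by (simp add: power2_eq_imp_eq)
qed

text \<open>Makes scalar multiplication an admissible \<open>f\<close> in the commutation clause of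
  \<open>blinfun_sqrt\<close>; this is how the roots become complex linear.\<close>

lemma bounded_linear_scaleC: "bounded_linear (\<lambda>x::'a::complex_hilbert. c *\<^sub>C x)"
proof (rule bounded_linear_intro)
  show "c *\<^sub>C (r *\<^sub>R x) = r *\<^sub>R c *\<^sub>C x" for r and x :: 'a
    by (simp add: scaleC_of_real[symmetric] scaleC_scaleC mult.commute)
  show "norm (c *\<^sub>C x) \<le> norm x * cmod c" for x :: 'a
    by (simp add: norm_scaleC)
qed (simp add: scaleC_add_right)

text \<open>Linearity in terms of points of the graph, which avoids \<open>the\<close> and separate
  membership in \<open>dom T\<close>.\<close>

lemma linear_op_iff:
  "linear_op T \<longleftrightarrow> T 0 = Some 0 \<and>
    (\<forall>x y u v. T x = Some u \<longrightarrow> T y = Some v \<longrightarrow> T (x + y) = Some (u + v)) \<and>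
    (\<forall>c x u. T x = Some u \<longrightarrow> T (c *\<^sub>C x) = Some (c *\<^sub>C u))"
    (is "?L \<longleftrightarrow> ?R")
proof
  assume L: ?L
  have sub: "csubspace (dom T)"
    and the_add: "\<And>x y. x \<in> dom T \<Longrightarrow> y \<in> dom T \<Longrightarrow> the (T (x + y)) = the (T x) + the (T y)"
    and the_scale: "\<And>c x. x \<in> dom T \<Longrightarrow> the (T (c *\<^sub>C x)) = c *\<^sub>C the (T x)"
    using L by (simp_all add: linear_op_def)
  have add: "T (x + y) = Some (u + v)" if "T x = Some u" "T y = Some v" for x y u v
  proof -
    have "x + y \<in> dom T"
      using that by (intro complex_vec.subspace_add[OF sub]) auto
    then show ?thesis
      using the_add[OF domI domI, OF that] that by auto
  qed
  have scale: "T (c *\<^sub>C x) = Some (c *\<^sub>C u)" if "T x = Some u" for c x u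
  proof -
    have "c *\<^sub>C x \<in> dom T"
      using that by (intro complex_vec.subspace_scale[OF sub]) auto
    then show ?thesis
      using the_scale[OF domI, OF that, of c] that by auto
  qed
  obtain u where "T 0 = Some u"
    using complex_vec.subspace_0[OF sub] by blast
  then have "T 0 = Some 0"
    using scale[of 0 u 0] by simp
  with add scale show ?R by simp
next
  assume R: ?R
  show ?L
    unfolding linear_op_def complex_vec.subspace_def
  proof (intro conjI ballI allI)
    show "0 \<in> dom T"
      using R by blast
    fix x c assume "x \<in> dom T"
    then obtain u where u: "T x = Some u" by blast
    have scale: "T (c *\<^sub>C x) = Some (c *\<^sub>C u)" using R u by simp
    then show "c *\<^sub>C x \<in> dom T" by blast
    show "the (T (c *\<^sub>C x)) = c *\<^sub>C the (T x)" using scale u by simp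
    fix y assume "y \<in> dom T"
    then obtain v where v: "T y = Some v" by blast
    have add: "T (x + y) = Some (u + v)" using R u v by simp
    then show "x + y \<in> dom T" by blast
    show "the (T (x + y)) = the (T x) + the (T y)" using add u v by simp
  qed
qed

lemma linear_op_zero: "linear_op T \<Longrightarrow> T 0 = Some 0"
  and linear_op_add: "linear_op T \<Longrightarrow> T x = Some u \<Longrightarrow> T y = Some v \<Longrightarrow> T (x + y) = Some (u + v)"
  and linear_op_scaleC: "linear_op T \<Longrightarrow> T x = Some u \<Longrightarrow> T (c *\<^sub>C x) = Some (c *\<^sub>C u)"
  by (simp_all add: linear_op_iff)

lemma linear_op_scaleR: "linear_op T \<Longrightarrow> T x = Some u \<Longrightarrow> T (r *\<^sub>R x) = Some (r *\<^sub>R u)"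
  using linear_op_scaleC[of T x u "of_real r"] by (simp add: scaleC_of_real)

lemma linear_op_diff:
  "linear_op T \<Longrightarrow> T x = Some u \<Longrightarrow> T y = Some v \<Longrightarrow> T (x - y) = Some (u - v)"
  using linear_op_add[of T x u "- 1 *\<^sub>R y" "- 1 *\<^sub>R v"] linear_op_scaleR[of T y v "- 1"] by simp

lemma graph_iff: "(x, u) \<in> Map.graph T \<longleftrightarrow> T x = Some u"
  by (simp add: Map.graph_def)

lemma subspace_graph: "linear_op T \<Longrightarrow> subspace (Map.graph T)"
  by (auto intro!: subspaceI simp: graph_iff zero_prod_def linear_op_zero linear_op_add linear_op_scaleR)

text \<open>Since \<open>dom T\<close> is a complex subspace, the real part of the inner product suffices.\<close>

lemma adjoint_op_iff:
  assumes lin: "linear_op T" and dense: "densely_defined T"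
  shows "adjoint_op T y = Some z \<longleftrightarrow> (\<forall>x u. T x = Some u \<longrightarrow> inner u y = inner x z)"
proof -
  let ?C = "\<lambda>z. \<forall>x\<in>dom T. cinner (the (T x)) y = cinner x z"
  let ?I = "\<lambda>z. \<forall>x u. T x = Some u \<longrightarrow> inner u y = inner x z"
  have CI: "?C z \<longleftrightarrow> ?I z" for z
  proof
    assume "?C z"
    then show "?I z" by (metis Re_cinner domI option.sel)
  next
    assume I: "?I z"
    show "?C z"
    proof
      fix x assume "x \<in> dom T"
      then obtain u where u: "T x = Some u" by blast
      have "T ((- \<i>) *\<^sub>C x) = Some ((- \<i>) *\<^sub>C u)"
        using linear_op_scaleC[OF lin u] .
      then have "inner ((- \<i>) *\<^sub>C u) y = inner ((- \<i>) *\<^sub>C x) z" "inner u y = inner x z"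
        using I u by blast+
      then have "cinner u y = cinner x z"
        by (intro complex_eqI) (simp_all only: Re_cinner Im_cinner)
      with u show "cinner (the (T x)) y = cinner x z" by simp
    qed
  qed
  \<comment> \<open>Two candidates differ by a vector orthogonal to the dense domain; this makes the
    description in \<open>adjoint_op\<close> meaningful.\<close>
  have uniq: "z = z'" if "?I z" "?I z'" for z z'
  proof -
    have "inner (z - z') x = 0" if "x \<in> dom T" for x
    proof -
      obtain u where "T x = Some u" using \<open>x \<in> dom T\<close> by blast
      with \<open>?I z\<close> \<open>?I z'\<close> have "inner x z = inner x z'" by metis
      then show ?thesis by (simp add: inner_simps inner_commute)
    qed
    then have "z - z' = 0"
      using dense orthogonal_to_dense unfolding densely_defined_def by blast
    then show ?thesis by simp
  qed
  have "(THE z. ?C z) = z" if "?I z" for z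
    using that uniq by (intro the_equality) (simp_all add: CI)
  then show ?thesis
    unfolding adjoint_op_def using CI by auto
qed

lemma linear_op_adjoint: "linear_op T \<Longrightarrow> densely_defined T \<Longrightarrow> linear_op (adjoint_op T)"
  unfolding linear_op_iff[of "adjoint_op T"] adjoint_op_iff
proof (intro conjI allI impI)
  fix c y z x u
  assume lin: "linear_op T" and I: "\<forall>x u. T x = Some u \<longrightarrow> inner u y = inner x z" and x: "T x = Some u"
  have "inner (cnj c *\<^sub>C u) y = inner (cnj c *\<^sub>C x) z"
    using I linear_op_scaleC[OF lin x] by blast
  then show "inner u (c *\<^sub>C y) = inner x (c *\<^sub>C z)"
    by (simp add: inner_scaleC_left)
qed (simp_all add: inner_simps)

text \<open>Each point of the graph of \<open>T\<close> imposes one closed condition on the graph of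
  the adjoint.\<close>

lemma closed_op_adjoint:
  assumes "linear_op T" "densely_defined T"
  shows "closed_op (adjoint_op T)"
proof -
  have "Map.graph (adjoint_op T) = (\<Inter>q\<in>Map.graph T. {p. inner (snd q) (fst p) = inner (fst q) (snd p)})"
    by (auto simp: Map.graph_def adjoint_op_iff[OF assms])
  moreover have "closed \<dots>"
    by (auto intro!: closed_INT closed_Collect_eq continuous_intros)
  ultimately show ?thesis
    using linear_op_adjoint[OF assms] by (simp add: closed_op_def)
qed

lemma linear_op_comp: "linear_op S \<Longrightarrow> linear_op T \<Longrightarrow> linear_op (S \<circ>\<^sub>m T)"
  unfolding linear_op_iff map_comp_Some_iff by blast

lemma adjoint_comp_iff:
  assumes "linear_op T" "densely_defined T"
  shows "(adjoint_op T \<circ>\<^sub>m T) x = Some z \<longleftrightarrow>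
    (\<exists>u. T x = Some u \<and> (\<forall>y v. T y = Some v \<longrightarrow> inner v u = inner y z))"
  by (simp add: map_comp_Some_iff adjoint_op_iff[OF assms])

subsection \<open>The resolvent of the square\<close>

text \<open>The axiom \<open>op_iff\<close> says that \<open>R\<close> is the inverse of \<open>1 + A\<close>.\<close>

locale positive_resolvent =
  fixes A :: "'a::complex_hilbert \<rightharpoonup> 'a" and R :: "'a \<Rightarrow>\<^sub>L 'a"
  assumes op_iff: "A x = Some z \<longleftrightarrow> R (x + z) = x"
    and sym: "symmetric_map R"
    and pos: "0 \<le> inner (R h) (h - R h)"
    and scaleC: "R (c *\<^sub>C h) = c *\<^sub>C R h"

text \<open>\<open>R h\<close> is the first component of the projection of \<open>(h, 0)\<close> onto the graph of \<open>T\<close>.\<close>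

lemma positive_resolvent_adjoint_comp:
  fixes T :: "'a::complex_hilbert \<rightharpoonup> 'b::complex_hilbert"
  assumes dense: "densely_defined T" and cl: "closed_op T"
  obtains R where "positive_resolvent (adjoint_op T \<circ>\<^sub>m T) R"
proof -
  define A where "A = adjoint_op T \<circ>\<^sub>m T"
  have lin: "linear_op T" and clg: "closed (Map.graph T)"
    using cl by (simp_all add: closed_op_def)
  note A_iff = adjoint_comp_iff[OF lin dense, folded A_def]
  have linA: "linear_op A"
    unfolding A_def by (intro linear_op_comp linear_op_adjoint lin dense)
  \<comment> \<open>If \<open>A d = - d\<close>, then \<open>inner u u = - inner d d\<close> for
    \<open>u\<close> the value of \<open>T\<close> at \<open>d\<close>.\<close>
  have inj: "d = 0" if dz: "A d = Some z" "d + z = 0" for d z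
  proof -
    obtain u where u: "T d = Some u" "\<forall>y v. T y = Some v \<longrightarrow> inner v u = inner y z"
      using dz(1) unfolding A_iff by blast
    then have "inner u u = inner d z" by blast
    moreover have "z = - d" using dz(2) by (simp add: eq_neg_iff_add_eq_0 add.commute)
    ultimately have "inner u u + inner d d = 0" by simp
    then show ?thesis
      by (metis add_nonneg_eq_0_iff inner_ge_zero inner_eq_zero_iff)
  qed
  have ex: "\<exists>x. A x = Some (h - x)" for h
  proof -
    obtain p where p: "p \<in> Map.graph T" "\<And>q. q \<in> Map.graph T \<Longrightarrow> inner ((h, 0) - p) q = 0"
      using orthogonal_projection_exists[OF clg subspace_graph[OF lin], of "(h, 0)"] by blast
    obtain x u where xu: "p = (x, u)" by (cases p)
    have "T x = Some u" using p(1) xu by (simp add: graph_iff)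
    \<comment> \<open>Orthogonality of \<open>(h - x, - u)\<close> to \<open>(y, v)\<close> is the
      weak form of \<open>adjoint_op T u = Some (h - x)\<close>.\<close>
    moreover have "inner v u = inner y (h - x)" if "T y = Some v" for y v
      using p(2)[of "(y, v)"] that by (simp add: xu graph_iff inner_simps inner_commute)
    ultimately show ?thesis unfolding A_iff by blast
  qed
  define r where "r h = (SOME x. A x = Some (h - x))" for h
  have r: "A (r h) = Some (h - r h)" for h
    unfolding r_def by (rule someI_ex[OF ex])
  have r_unique: "r (x + z) = x" if "A x = Some z" for x z
  proof -
    have "A (r (x + z) - x) = Some (x + z - r (x + z) - z)"
      using linear_op_diff[OF linA r that] .
    then have "r (x + z) - x = 0" by (rule inj) simp
    then show ?thesis by simp
  qed
  have r_iff: "A x = Some z \<longleftrightarrow> r (x + z) = x" for x z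
    using r_unique r[of "x + z"] by auto
  have r_add: "r (h + k) = r h + r k" for h k
    using r_unique[OF linear_op_add[OF linA r[of h] r[of k]]] by (simp add: algebra_simps)
  have r_scaleR: "r (c *\<^sub>R h) = c *\<^sub>R r h" for c h
    using r_unique[OF linear_op_scaleR[OF linA r[of h], of c]] by (simp add: scaleR_diff_right)
  have r_scaleC: "r (c *\<^sub>C h) = c *\<^sub>C r h" for c h
    using r_unique[OF linear_op_scaleC[OF linA r[of h], of c]]
    by (simp add: scaleC_add_right[symmetric])
  \<comment> \<open>With \<open>u\<close> and \<open>v\<close> the values of \<open>T\<close> at
    \<open>r h\<close> and \<open>r k\<close>, the form \<open>inner u v\<close> yields positivity
    for \<open>k = h\<close> and the symmetry of \<open>r\<close> in general.\<close>
  have form: "\<exists>u v. inner (r h) (k - r k) = inner u v \<and> inner (r k) (h - r h) = inner v u \<and>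
      T (r h) = Some u \<and> T (r k) = Some v" for h k
  proof -
    obtain u where u: "T (r h) = Some u" "\<forall>y v. T y = Some v \<longrightarrow> inner v u = inner y (h - r h)"
      using r[of h] unfolding A_iff by metis
    obtain v where v: "T (r k) = Some v" "\<forall>y u. T y = Some u \<longrightarrow> inner u v = inner y (k - r k)"
      using r[of k] unfolding A_iff by metis
    from u v have "inner (r h) (k - r k) = inner u v" "inner (r k) (h - r h) = inner v u"
      by fastforce+
    with u(1) v(1) show ?thesis by blast
  qed
  have r_pos: "0 \<le> inner (r h) (h - r h)" for h
    using form[of h h] by auto
  have r_sym: "inner (r h) k = inner h (r k)" for h k
    using form[of h k] by (auto simp: inner_simps inner_commute)
  have "norm (r h) \<le> norm h" for h
  proof -
    have "norm (r h) * norm (r h) \<le> norm (r h) * norm h"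
      using r_pos[of h] norm_cauchy_schwarz[of "r h" h]
      by (simp add: inner_simps power2_norm_eq_inner[symmetric] power2_eq_square)
    then show ?thesis
      by (cases "r h = 0") simp_all
  qed
  then have "bounded_linear r"
    by (intro bounded_linear_intro[of _ 1]) (simp_all add: r_add r_scaleR)
  then have app: "blinfun_apply (Blinfun r) = r" by (rule bounded_linear_Blinfun_apply)
  have "positive_resolvent A (Blinfun r)"
    by unfold_locales (simp_all add: app r_iff symmetric_map_def r_sym[symmetric] r_pos r_scaleC)
  then show thesis using that by (simp add: A_def)
qed

section \<open>Bounds on the resolvent and the minimum of \<open>A\<close>\<close>

context positive_resolvent
begin

lemma apply_resolvent: "A (R h) = Some (h - R h)"
  by (simp add: op_iff)

lemma op_cases:
  assumes "A x = Some z"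
  obtains h where "x = R h" "z = h - R h"
  using assms that[of "x + z"] by (simp add: op_iff)

text \<open>\<open>R h = 0\<close> means that \<open>A\<close> takes the value \<open>h\<close> at
  \<open>0\<close>, where it also takes the value \<open>0\<close>.\<close>

lemma inj: "R h = 0 \<Longrightarrow> h = 0"
  using op_iff[of 0 h] op_iff[of 0 0] by (simp add: blinfun.bilinear_simps)

lemma norm_split: "(norm (R h))\<^sup>2 + (norm (h - R h))\<^sup>2 \<le> (norm h)\<^sup>2"
proof -
  have "(norm h)\<^sup>2 = (norm (R h))\<^sup>2 + (norm (h - R h))\<^sup>2 + 2 * inner (R h) (h - R h)"
    by (simp add: power2_norm_eq_inner inner_simps inner_commute)
  with pos[of h] show ?thesis by linarith
qed

text \<open>These are the hypotheses under which \<open>blinfun_sqrt\<close> applies to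
  \<open>1 - R\<close> and to \<open>R\<close>, respectively.\<close>

lemma norm_le: "norm R \<le> 1" "norm (id_blinfun - R) \<le> 1"
proof -
  have "norm (R h) \<le> norm h" "norm (h - R h) \<le> norm h" for h
  proof -
    have "(norm (R h))\<^sup>2 \<le> (norm h)\<^sup>2" "(norm (h - R h))\<^sup>2 \<le> (norm h)\<^sup>2"
      using norm_split[of h] zero_le_power2[of "norm (R h)"] zero_le_power2[of "norm (h - R h)"]
      by linarith+
    then show "norm (R h) \<le> norm h" "norm (h - R h) \<le> norm h"
      by (blast intro: power2_le_imp_le norm_ge_zero)+
  qed
  then show "norm R \<le> 1" "norm (id_blinfun - R) \<le> 1"
    by (rule_tac [!] norm_blinfun_bound) (simp_all add: blinfun.bilinear_simps)
qed

text \<open>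
  With \<open>E = 1 - (1 + \<mu>) R\<close> and \<open>F\<close> a positive multiple of \<open>1 - (1 - \<mu>) R\<close>, i.e. \<open>A - \<mu>\<close> and \<open>A + \<mu>\<close>
  multiplied by \<open>R\<close>, the hypothesis reads \<open>E F \<ge> 0\<close>. Since \<open>F\<close> is positive and injective, \<open>E \<ge> 0\<close>.
\<close>

lemma minimum_eigenvector:
  assumes \<mu>: "0 \<le> \<mu>" and le: "\<And>x z. A x = Some z \<Longrightarrow> \<mu> * norm x \<le> norm z"
    and x\<^sub>0: "A x\<^sub>0 = Some z\<^sub>0" "norm z\<^sub>0 = \<mu> * norm x\<^sub>0"
  shows "z\<^sub>0 = \<mu> *\<^sub>R x\<^sub>0" and "A x = Some z \<Longrightarrow> \<mu> * (norm x)\<^sup>2 \<le> inner x z"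
proof -
  have "z\<^sub>0 = \<mu> *\<^sub>R x\<^sub>0 \<and> (\<forall>h. \<mu> * (norm (R h))\<^sup>2 \<le> inner (R h) (h - R h))"
  proof (cases "\<mu> = 0")
    \<comment> \<open>For \<open>\<mu> = 0\<close> the operator \<open>F\<close> would be
      \<open>1 - R\<close>, which has the kernel of \<open>A\<close> and may fail to be
      injective.\<close>
    case True
    with x\<^sub>0 pos show ?thesis by simp
  next
    case False
    with \<mu> have \<mu>: "\<mu> > 0" by simp
    define E where "E = id_blinfun - (1 + \<mu>) *\<^sub>R R"
    define F where "F = (1 / (1 + \<mu>)) *\<^sub>R (id_blinfun - (1 - \<mu>) *\<^sub>R R)"
    have E: "E x = x - (1 + \<mu>) *\<^sub>R R x" for x
      by (simp add: E_def blinfun.bilinear_simps)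
    have F: "F x = (1 / (1 + \<mu>)) *\<^sub>R (x - R x + \<mu> *\<^sub>R R x)" for x
      by (simp add: F_def blinfun.bilinear_simps algebra_simps)
    have RR: "inner (R x) y = inner x (R y)" for x y
      using sym by (rule symmetric_mapD)
    have symE: "symmetric_map E"
      by (simp add: symmetric_map_def E inner_simps RR)
    have symF: "symmetric_map F"
      by (simp add: symmetric_map_def F inner_simps RR)
    have EF: "E (F x) = F (E x)" for x
      by (simp add: E F blinfun.bilinear_simps algebra_simps)
    \<comment> \<open>At \<open>x = R h\<close> with \<open>z = h - R h\<close> the right side is
      the difference of the squares of \<open>norm z\<close> and \<open>\<mu> * norm x\<close>,
      nonnegative by \<open>le\<close> and zero at a minimizer.\<close>
    have form: "(1 + \<mu>) * inner (E (F h)) h = (norm (h - R h))\<^sup>2 - \<mu>\<^sup>2 * (norm (R h))\<^sup>2" for h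
    proof -
      have "(1 + \<mu>) * inner (E (F h)) h = (1 + \<mu>) * inner (F h) (E h)"
        using symE by (simp add: symmetric_mapD)
      also have "\<dots> = inner (h - R h + \<mu> *\<^sub>R R h) (h - R h - \<mu> *\<^sub>R R h)"
      proof -
        have "E h = h - R h - \<mu> *\<^sub>R R h" by (simp add: E algebra_simps)
        then show ?thesis using \<mu> by (simp only: F) simp
      qed
      also have "\<dots> = (norm (h - R h))\<^sup>2 - \<mu>\<^sup>2 * (norm (R h))\<^sup>2"
        unfolding power2_norm_eq_inner
        by (simp add: inner_simps inner_commute[of h "R h"] power2_eq_square algebra_simps)
      finally show ?thesis .
    qed
    have posEF: "0 \<le> inner (E (F h)) h" for h
    proof -
      have "(\<mu> * norm (R h))\<^sup>2 \<le> (norm (h - R h))\<^sup>2"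
        using le[OF apply_resolvent] \<mu> by (intro power_mono) auto
      then have "0 \<le> (1 + \<mu>) * inner (E (F h)) h"
        using form[of h] by (simp add: power_mult_distrib)
      with \<mu> show ?thesis by (simp add: zero_le_mult_iff)
    qed
    have injF: "h = 0" if "F h = 0" for h
    proof -
      have "h - R h = - (\<mu> *\<^sub>R R h)"
        using that \<mu> by (simp add: F eq_neg_iff_add_eq_0)
      with pos[of h] have "\<mu> * inner (R h) (R h) \<le> 0" by simp
      with \<mu> have "R h = 0"
        by (metis inner_ge_zero inner_eq_zero_iff mult_le_0_iff order_antisym linorder_not_le)
      then show ?thesis by (rule inj)
    qed
    \<comment> \<open>The factor \<open>1 / (1 + \<mu>)\<close> makes \<open>1 - F\<close> a convex
      combination of \<open>1 - R\<close> and \<open>R\<close>, so that \<open>F\<close> has a root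
      \<open>G\<close>.\<close>
    have "norm (id_blinfun - F) \<le> 1"
    proof -
      have "id_blinfun - F = (1 / (1 + \<mu>)) *\<^sub>R (\<mu> *\<^sub>R (id_blinfun - R) + R)"
      proof -
        have "(1 + \<mu>) *\<^sub>R (id_blinfun - F) = \<mu> *\<^sub>R (id_blinfun - R) + R"
          using \<mu> by (simp add: F_def scaleR_diff_right scaleR_left.add scaleR_left.diff)
        then have "(1 / (1 + \<mu>)) *\<^sub>R ((1 + \<mu>) *\<^sub>R (id_blinfun - F)) =
            (1 / (1 + \<mu>)) *\<^sub>R (\<mu> *\<^sub>R (id_blinfun - R) + R)" by (rule arg_cong)
        then show ?thesis using \<mu> by simp
      qed
      moreover have "norm (\<mu> *\<^sub>R (id_blinfun - R) + R) \<le> \<mu> * 1 + 1"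
        using \<mu> norm_le by (intro norm_triangle_le add_mono) (auto intro: mult_left_le)
      ultimately show ?thesis using \<mu> by simp
    qed
    then obtain G :: "'a \<Rightarrow>\<^sub>L 'a" where G: "\<And>x. G (G x) = F x" "symmetric_map G"
      and commG: "\<And>f x. bounded_linear f \<Longrightarrow> (\<And>x. f (F x) = F (f x)) \<Longrightarrow> f (G x) = G (f x)"
      using blinfun_sqrt[OF _ symF] by metis
    \<comment> \<open>\<open>G\<close> is symmetric and injective, so its range has trivial
      orthogonal complement.\<close>
    have "closure (range G) = UNIV"
    proof (rule dense_if_orthogonal_trivial)
      show "subspace (range G)"
        by (simp add: linear_subspace_image blinfun.bounded_linear_right bounded_linear.linear)
      show "x = 0" if "\<And>z. z \<in> range G \<Longrightarrow> inner x z = 0" for x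
      proof -
        have "inner (G x) (G x) = 0"
          using that[of "G (G x)"] symmetric_mapD[OF G(2)] by simp
        then have "F x = 0" using G(1)[of x] by (simp add: blinfun.bilinear_simps)
        then show ?thesis by (rule injF)
      qed
    qed
    moreover have "closure (range G) \<subseteq> {k. 0 \<le> inner (E k) k}"
    proof (rule closure_minimal)
      show "closed {k. 0 \<le> inner (E k) k}"
        by (intro closed_Collect_le continuous_intros)
      \<comment> \<open>\<open>E\<close> commutes with \<open>G\<close>, so its form on
        \<open>range G\<close> is the form of \<open>E F\<close>; density then gives positivity of
        \<open>E\<close> everywhere.\<close>
      have "inner (E (G h)) (G h) = inner (E (F h)) h" for h
        using commG[OF blinfun.bounded_linear_right, of E] EF symmetric_mapD[OF G(2)] G(1) by metis
      then show "range G \<subseteq> {k. 0 \<le> inner (E k) k}"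
        using posEF by auto
    qed
    ultimately have posE: "0 \<le> inner (E k) k" for k by blast
    \<comment> \<open>The form of \<open>E R\<close> at \<open>h\<close> is
      \<open>inner x z - \<mu> * inner x x\<close> for \<open>x = R h\<close>,
      \<open>z = h - R h\<close>, which is the lower bound sought.\<close>
    have "0 \<le> inner (E (R h)) h" for h
      by (rule positive_commuting_compose[OF blinfun.bounded_linear_right posE norm_le(2) sym])
        (simp add: E blinfun.bilinear_simps)
    moreover have "inner (E (R h)) h = inner (R h) (h - R h) - \<mu> * (norm (R h))\<^sup>2" for h
      by (simp add: E inner_simps RR power2_norm_eq_inner algebra_simps)
    moreover have "z\<^sub>0 = \<mu> *\<^sub>R x\<^sub>0"
    proof -
      obtain h where h: "x\<^sub>0 = R h" "z\<^sub>0 = h - R h" using op_cases x\<^sub>0(1) by blast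
      \<comment> \<open>Attainment makes the positive form of \<open>E F\<close> vanish at
        \<open>h\<close>. Hence \<open>F (E h) = 0\<close>, and injectivity of \<open>F\<close>
        leaves \<open>E h = 0\<close>, the eigenvalue equation.\<close>
      have "(1 + \<mu>) * inner (E (F h)) h = 0"
        using x\<^sub>0(2) by (simp add: form h power_mult_distrib)
      with \<mu> have "inner (E (F h)) h = 0" by simp
      moreover have "linear (\<lambda>h. E (F h))"
        by (intro bounded_linear.linear bounded_linear_compose[OF blinfun.bounded_linear_right]
            blinfun.bounded_linear_right)
      moreover have "symmetric_map (\<lambda>h. E (F h))"
        using symE symF EF by (simp add: symmetric_map_def)
      ultimately have "E (F h) = 0"
        using positive_map_null posEF by metis
      with EF injF have "E h = 0" by metis
      then show ?thesis by (simp add: E h algebra_simps)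
    qed
    ultimately show ?thesis by fastforce
  qed
  then show "z\<^sub>0 = \<mu> *\<^sub>R x\<^sub>0" "A x = Some z \<Longrightarrow> \<mu> * (norm x)\<^sup>2 \<le> inner x z"
    using op_cases by blast+
qed

end

subsection \<open>The positive square root\<close>

text \<open>Commutation is stated for all real bounded linear \<open>f\<close>, which covers complex
  scalars, \<open>P\<close> and \<open>Q\<close> themselves, and the operator \<open>K\<close> in
  \<open>root_op_unique\<close>.\<close>

locale resolvent_roots = positive_resolvent A R
  for A :: "'a::complex_hilbert \<rightharpoonup> 'a" and R :: "'a \<Rightarrow>\<^sub>L 'a" +
  fixes Q P :: "'a \<Rightarrow>\<^sub>L 'a"
  assumes QQ: "Q (Q h) = R h" and PP: "P (P h) = h - R h"
    and symQ: "symmetric_map Q" and symP: "symmetric_map P"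
    and posPQ: "0 \<le> inner (P (Q h)) h"
    and commQ: "bounded_linear f \<Longrightarrow> (\<And>h. f (R h) = R (f h)) \<Longrightarrow> f (Q h) = Q (f h)"
    and commP: "bounded_linear f \<Longrightarrow> (\<And>h. f (R h) = R (f h)) \<Longrightarrow> f (P h) = P (f h)"

lemma (in positive_resolvent) resolvent_roots_exist:
  obtains Q P where "resolvent_roots A R Q P"
proof -
  have compl: "norm (id_blinfun - (id_blinfun - R)) \<le> 1" "symmetric_map (id_blinfun - R)"
    using norm_le(1) sym by (simp_all add: symmetric_map_def blinfun.bilinear_simps inner_simps)
  show thesis
  proof (rule blinfun_sqrt[OF norm_le(2) sym], rule blinfun_sqrt[OF compl])
    fix Q P :: "'a \<Rightarrow>\<^sub>L 'a"
    assume Q: "\<And>h. Q (Q h) = R h" "symmetric_map Q" "norm (id_blinfun - Q) \<le> 1"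
      and commQ: "\<And>f h. bounded_linear f \<Longrightarrow> (\<And>h. f (R h) = R (f h)) \<Longrightarrow> f (Q h) = Q (f h)"
      and P: "\<And>h. P (P h) = (id_blinfun - R) h" "symmetric_map P" "\<And>h. 0 \<le> inner (P h) h"
      and commP: "\<And>f h. bounded_linear f \<Longrightarrow>
        (\<And>h. f ((id_blinfun - R) h) = (id_blinfun - R) (f h)) \<Longrightarrow> f (P h) = P (f h)"
    have commP': "f (P h) = P (f h)" if f: "bounded_linear f" "\<And>h. f (R h) = R (f h)" for f h
      by (rule commP[OF f(1)])
        (simp add: blinfun.bilinear_simps linear_diff[OF bounded_linear.linear[OF f(1)]] f(2))
    have RP: "R (P h) = P (R h)" for h
      by (rule commP'[OF blinfun.bounded_linear_right]) simp
    have PQ: "P (Q h) = Q (P h)" for h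
      by (rule commQ[OF blinfun.bounded_linear_right]) (simp add: RP)
    have "resolvent_roots A R Q P"
    proof unfold_locales
      show "0 \<le> inner (P (Q h)) h" for h
        by (rule positive_commuting_compose[OF blinfun.bounded_linear_right P(3) Q(3) Q(2) PQ])
      show "f (Q h) = Q (f h)" if "bounded_linear f" "\<And>h. f (R h) = R (f h)" for f h
        using commQ[OF that] .
      show "f (P h) = P (f h)" if "bounded_linear f" "\<And>h. f (R h) = R (f h)" for f h
        using commP'[OF that] .
    qed (simp_all add: P(1) P(2) Q(1) Q(2) blinfun.bilinear_simps)
    then show thesis by (rule that)
  qed
qed

context resolvent_roots
begin

lemma PQ: "P (Q h) = Q (P h)"
  by (rule commQ[OF blinfun.bounded_linear_right], rule commP[symmetric, OF blinfun.bounded_linear_right]) simp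

lemma injQ: "Q h = 0 \<Longrightarrow> h = 0"
  using QQ[of h] inj[of h] by (simp add: blinfun.bilinear_simps)

lemma Q_eq_iff: "Q h = Q k \<longleftrightarrow> h = k"
  using injQ[of "h - k"] by (auto simp: blinfun.bilinear_simps)

text \<open>The inverse of \<open>Q\<close> applied after \<open>P\<close>, on its maximal domain.
  By \<open>graph_param\<close> this is also \<open>P\<close> after the inverse of \<open>Q\<close>;
  the equation form makes the adjoint easy to compute.\<close>

definition root_op :: "'a \<rightharpoonup> 'a"
  where "root_op x = (if \<exists>z. P x = Q z then Some (THE z. P x = Q z) else None)"

lemma root_op_iff: "root_op x = Some z \<longleftrightarrow> P x = Q z"
proof
  assume "P x = Q z"
  moreover from this have "(THE z. P x = Q z) = z"
    by (intro the_equality) (auto simp: Q_eq_iff)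
  ultimately show "root_op x = Some z" by (auto simp: root_op_def)
next
  assume *: "root_op x = Some z"
  then obtain z' where z': "P x = Q z'" by (auto simp: root_op_def split: if_splits)
  moreover from this have "(THE z. P x = Q z) = z'"
    by (intro the_equality) (auto simp: Q_eq_iff)
  ultimately show "P x = Q z" using * by (auto simp: root_op_def split: if_splits)
qed

text \<open>As \<open>P\<^sup>2 + Q\<^sup>2 = 1\<close>, the parameter of a point \<open>(x, z)\<close> of the graph is \<open>Q x + P z\<close>.\<close>

lemma graph_param: "P x = Q z \<longleftrightarrow> (\<exists>w. x = Q w \<and> z = P w)"
proof
  assume *: "P x = Q z"
  have "Q (Q x + P z) = Q (Q x) + P (P x)"
    using * PQ by (simp add: blinfun.bilinear_simps)
  moreover have "P (Q x + P z) = Q (Q z) + P (P z)"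
    using * PQ by (simp add: blinfun.bilinear_simps)
  ultimately show "\<exists>w. x = Q w \<and> z = P w"
    by (intro exI[of _ "Q x + P z"]) (simp add: QQ PP)
qed (auto simp: PQ)

lemma root_op_Q: "root_op (Q w) = Some (P w)"
  by (simp add: root_op_iff PQ)

lemma root_op_cases:
  assumes "root_op x = Some z"
  obtains w where "x = Q w" "z = P w"
  using assms by (auto simp: root_op_iff graph_param)

lemma linear_root_op: "linear_op root_op"
proof -
  \<comment> \<open>Scalar multiplication commutes with \<open>R\<close>, hence with both
    roots.\<close>
  have "Q (c *\<^sub>C h) = c *\<^sub>C Q h" "P (c *\<^sub>C h) = c *\<^sub>C P h" for c h
    using commQ[OF bounded_linear_scaleC] commP[OF bounded_linear_scaleC] scaleC by metis+
  then show ?thesis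
    by (simp add: linear_op_iff root_op_iff blinfun.bilinear_simps)
qed

text \<open>Testing against the graph points \<open>(Q w, P w)\<close> and moving \<open>P\<close>
  and \<open>Q\<close> across turns the adjoint condition on \<open>(y, z)\<close> into
  \<open>P y = Q z\<close>. The domain contains the dense range of \<open>Q\<close>.\<close>

lemma selfadjoint_root_op: "selfadjoint_op root_op"
proof -
  have "closure (range Q) = UNIV"
  proof (rule dense_if_orthogonal_trivial)
    show "subspace (range Q)"
      by (simp add: linear_subspace_image blinfun.bounded_linear_right bounded_linear.linear)
    show "x = 0" if x: "\<And>z. z \<in> range Q \<Longrightarrow> inner x z = 0" for x
    proof -
      have "inner (Q x) (Q x) = 0"
        using x[of "Q (Q x)"] symmetric_mapD[OF symQ] by simp
      then show ?thesis by (simp add: injQ)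
    qed
  qed
  moreover have "range Q \<subseteq> dom root_op"
    using root_op_Q by blast
  ultimately have dense: "densely_defined root_op"
    unfolding densely_defined_def using closure_mono by blast
  have "adjoint_op root_op y = Some z \<longleftrightarrow> root_op y = Some z" for y z
  proof -
    have "adjoint_op root_op y = Some z \<longleftrightarrow> (\<forall>w. inner (P w) y = inner (Q w) z)"
      unfolding adjoint_op_iff[OF linear_root_op dense]
      using root_op_Q by (auto elim!: root_op_cases)
    also have "\<dots> \<longleftrightarrow> (\<forall>w. inner w (P y - Q z) = 0)"
      by (simp add: symmetric_mapD[OF symP] symmetric_mapD[OF symQ] inner_diff_right)
    also have "\<dots> \<longleftrightarrow> P y = Q z"
      by (metis inner_eq_zero_iff inner_zero_right right_minus_eq)
    finally show ?thesis by (simp add: root_op_iff)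
  qed
  then have "adjoint_op root_op = root_op"
    by (intro ext) (metis not_None_eq)
  then show ?thesis
    by (simp add: selfadjoint_op_def linear_root_op dense)
qed

lemma positive_root_op: "positive_op root_op"
proof -
  have "cinner z x \<in> \<real>\<^sub>\<ge>\<^sub>0" if xz: "root_op x = Some z" for x z
  proof -
    obtain w where w: "x = Q w" "z = P w"
      using xz by (rule root_op_cases)
    have "0 \<le> inner (P w) (Q w)"
      using posPQ[of w] PQ[of w] symmetric_mapD[OF symQ, of "P w" w] by simp
    then have "0 \<le> Re (cinner z x)" by (simp add: w Re_cinner)
    \<comment> \<open>Symmetry makes the value real: it is used at \<open>x\<close> and at
      \<open>- \<i>\<close> times \<open>x\<close>.\<close>
    moreover have "cinner z x = cinner x z"
    proof -
      have "adjoint_op root_op x = Some z" "densely_defined root_op"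
        using selfadjoint_root_op xz by (simp_all add: selfadjoint_op_def)
      then have sym: "inner u x = inner y z" if "root_op y = Some u" for y u
        using adjoint_op_iff[OF linear_root_op] that by blast
      have "root_op ((- \<i>) *\<^sub>C x) = Some ((- \<i>) *\<^sub>C z)"
        using linear_op_scaleC[OF linear_root_op xz] .
      from sym[OF this] sym[OF xz] show ?thesis
        by (intro complex_eqI) (simp_all only: Re_cinner Im_cinner)
    qed
    then have "Im (cinner z x) = 0"
      by (metis cinner_commute cnj.simps(2) equal_neg_zero)
    ultimately show ?thesis by (simp add: complex_nonneg_Reals_iff)
  qed
  then show ?thesis by (auto simp: positive_op_def)
qed

lemma root_op_square: "root_op \<circ>\<^sub>m root_op = A"
proof -
  have "(root_op \<circ>\<^sub>m root_op) x = Some z \<longleftrightarrow> A x = Some z" for x z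
  proof
    assume "(root_op \<circ>\<^sub>m root_op) x = Some z"
    then obtain u where u: "root_op x = Some u" "root_op u = Some z"
      by (auto simp: map_comp_Some_iff)
    obtain w w' where w: "x = Q w" "u = P w" "u = Q w'" "z = P w'"
      using u by (metis root_op_cases)
    \<comment> \<open>The middle value gives \<open>P w = Q w'\<close>, again a point of the graph,
      which can be parametrized once more.\<close>
    then obtain v where "w = Q v" "w' = P v" using graph_param by metis
    with w show "A x = Some z" using apply_resolvent[of v] by (simp add: QQ PP)
  next
    assume "A x = Some z"
    then obtain v where v: "x = R v" "z = v - R v" by (rule op_cases)
    have "root_op x = Some (P (Q v))"
      using root_op_Q[of "Q v"] by (simp add: v QQ)
    moreover have "root_op (P (Q v)) = Some z"
      using root_op_Q[of "P v"] by (simp add: v PP PQ)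
    ultimately show "(root_op \<circ>\<^sub>m root_op) x = Some z" by (simp add: map_comp_Some_iff)
  qed
  then show ?thesis by (intro ext) (metis not_None_eq)
qed

text \<open>
  For any positive self-adjoint \<open>S\<close> with \<open>S\<^sup>2 = A\<close>, the operator \<open>S R\<close> is a bounded positive square
  root of \<open>R (1 - R)\<close> that commutes with \<open>R\<close>, hence equals \<open>P Q\<close>; and \<open>R S \<subseteq> S R\<close> recovers \<open>S\<close>.
\<close>

lemma root_op_unique:
  assumes sa: "selfadjoint_op S" and pos: "positive_op S" and sq: "S \<circ>\<^sub>m S = A"
  shows "S = root_op"
proof -
  have lin: "linear_op S" and dense: "densely_defined S" and adj: "adjoint_op S = S"
    using sa by (simp_all add: selfadjoint_op_def)
  have S_iff: "S y = Some z \<longleftrightarrow> (\<forall>x u. S x = Some u \<longrightarrow> inner u y = inner x z)" for y z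
    using adjoint_op_iff[OF lin dense, of y z] adj by simp
  have S_sym: "inner u y = inner x z" if "S x = Some u" "S y = Some z" for x y u z
    using that S_iff by blast
  have S_pos: "0 \<le> inner u x" if "S x = Some u" for x u
  proof -
    have "cinner u x \<in> \<real>\<^sub>\<ge>\<^sub>0"
      using pos that unfolding positive_op_def by (metis domI option.sel)
    then show ?thesis by (simp add: complex_nonneg_Reals_iff Re_cinner)
  qed
  have A_iff: "A x = Some z \<longleftrightarrow> (\<exists>u. S x = Some u \<and> S u = Some z)" for x z
    by (simp add: sq[symmetric] map_comp_Some_iff)
  \<comment> \<open>\<open>K\<close> is defined everywhere, since \<open>R h\<close> lies in the
    domain of \<open>A\<close>, which is contained in that of \<open>S\<close>.\<close>
  define K where "K h = the (S (R h))" for h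
  have K: "S (R h) = Some (K h)" "S (K h) = Some (h - R h)" for h
    using apply_resolvent[of h] by (auto simp: K_def A_iff)
  have K_eq: "K h = u" if "S (R h) = Some u" for h u
    using that K(1)[of h] by simp
  have K_add: "K (h + k) = K h + K k" for h k
    using linear_op_add[OF lin K(1) K(1), of h k] by (intro K_eq) (simp add: blinfun.bilinear_simps)
  have K_scaleR: "K (r *\<^sub>R h) = r *\<^sub>R K h" for r h
    using linear_op_scaleR[OF lin K(1), of r h] by (intro K_eq) (simp add: blinfun.bilinear_simps)
  have K_norm: "(norm (K h))\<^sup>2 = inner (R h) (h - R h)" for h
    using S_sym[OF K(1) K(2), of h h] by (simp add: power2_norm_eq_inner)
  have "norm (K h) \<le> norm h" for h
  proof (rule power2_le_imp_le)
    have "2 * inner (R h) (h - R h) \<le> (norm h)\<^sup>2"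
    proof -
      have "(norm h)\<^sup>2 = (norm (R h))\<^sup>2 + (norm (h - R h))\<^sup>2 + 2 * inner (R h) (h - R h)"
        by (simp add: power2_norm_eq_inner inner_simps inner_commute)
      then show ?thesis using zero_le_power2[of "norm (R h)"] zero_le_power2[of "norm (h - R h)"]
        by linarith
    qed
    then show "(norm (K h))\<^sup>2 \<le> (norm h)\<^sup>2"
      using positive_resolvent.pos[OF positive_resolvent_axioms, of h] K_norm[of h] by linarith
  qed simp
  then have blK: "bounded_linear K"
    by (intro bounded_linear_intro[of _ 1]) (simp_all add: K_add K_scaleR)
  then have linK: "linear K" by (rule bounded_linear.linear)
  have K_diff: "K (h - k) = K h - K k" for h k
    using linK by (rule linear_diff)
  have RK: "R (K h) = K (R h)" for h
  proof -
    have "S (R (R h)) = Some (K (R h))" "S (K (R h)) = Some (R (h - R h))"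
      using K[of "R h"] by (simp_all add: blinfun.bilinear_simps)
    moreover have "S (R (h - R h)) = Some (K h - K (R h))"
      using K(1)[of "h - R h"] by (simp add: K_diff)
    \<comment> \<open>\<open>S\<close> has been applied twice to \<open>K (R h)\<close>; inverting
      \<open>1 + A\<close> cancels \<open>K (R h)\<close> in the sum and leaves
      \<open>R (K h)\<close>.\<close>
    ultimately have "A (K (R h)) = Some (K h - K (R h))"
      using A_iff by blast
    then show ?thesis by (simp add: op_iff)
  qed
  have symK: "symmetric_map K"
  proof -
    have "inner (K x) y = inner x (K y)" for x y
    proof -
      \<comment> \<open>Symmetry of \<open>S\<close> between \<open>R x\<close> and
        \<open>R y\<close>, and between \<open>K x\<close> and \<open>K y\<close>; the two equations
        combine to the claim.\<close>
      have "inner (K x) (R y) = inner (R x) (K y)" "inner (x - R x) (K y) = inner (K x) (y - R y)"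
        using S_sym K by blast+
      then show ?thesis by (simp add: inner_simps)
    qed
    then show ?thesis by (simp add: symmetric_map_def)
  qed
  have posK: "0 \<le> inner (K x) x" for x
    using S_pos[OF K(1)[of x]] S_pos[OF K(2)[of x]] by (simp add: inner_simps inner_commute)
  have KK: "K (K x) = P (Q (P (Q x)))" for x
  proof -
    have "K (K x) = R x - R (R x)"
      using K(2)[of "R x"] by (intro K_eq) (simp add: RK)
    also have "\<dots> = P (P (Q (Q x)))" by (simp add: PP QQ)
    finally show ?thesis by (simp add: PQ)
  qed
  have KPQ: "K x = P (Q x)" for x
  proof (rule positive_root_unique[of K "\<lambda>x. P (Q x)"])
    show "linear (\<lambda>x. P (Q x))"
      by (intro bounded_linear.linear bounded_linear_compose[OF blinfun.bounded_linear_right]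
          blinfun.bounded_linear_right)
    show "symmetric_map (\<lambda>x. P (Q x))"
      using symP symQ by (simp add: symmetric_map_def PQ)
    show "K (P (Q x)) = P (Q (K x))" for x
      using commP[OF blK RK[symmetric]] commQ[OF blK RK[symmetric]] by simp
  qed (use linK symK posK posPQ KK in auto)
  have S_le: "root_op x = Some u" if "S x = Some u" for x u
  proof -
    \<comment> \<open>This is \<open>R S \<subseteq> S R\<close> in weak form; one factor
      \<open>Q\<close> is then cancelled from \<open>R u = P (Q x)\<close>.\<close>
    have "inner (R u) y = inner (K x) y" for y
      using S_sym[OF that K(1)] symmetric_mapD[OF sym] symmetric_mapD[OF symK] by metis
    then have "R u = K x" by (metis inner_commute vector_eq_ldot)
    then have "Q (Q u) = Q (P x)" by (simp add: QQ KPQ PQ)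
    then show ?thesis by (simp add: Q_eq_iff root_op_iff)
  qed
  \<comment> \<open>A self-adjoint operator has no proper symmetric extension:
    \<open>root_op\<close> is symmetric and extends \<open>S\<close>, so its values satisfy the
    adjoint condition for \<open>S\<close>.\<close>
  have "S y = Some z" if "root_op y = Some z" for y z
  proof -
    have "adjoint_op root_op y = Some z" "densely_defined root_op"
      using selfadjoint_root_op that by (simp_all add: selfadjoint_op_def)
    then have "inner u y = inner x z" if "root_op x = Some u" for x u
      using adjoint_op_iff[OF linear_root_op] that by blast
    then show ?thesis
      using S_le by (intro S_iff[THEN iffD2]) blast
  qed
  with S_le show ?thesis by (intro ext) (metis not_None_eq)
qed

lemma sqrt_op_eq: "sqrt_op A = root_op"
  unfolding sqrt_op_def
  by (rule the_equality) (intro conjI selfadjoint_root_op positive_root_op root_op_square,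
      elim conjE, rule root_op_unique)

end

text \<open>Shows that the description in \<open>sqrt_op\<close> denotes an actual root, so that |T|
  is known only through these two facts from here on.\<close>

lemma abs_op_properties:
  assumes "densely_defined T" "closed_op T"
  shows "selfadjoint_op (abs_op T)" "abs_op T \<circ>\<^sub>m abs_op T = adjoint_op T \<circ>\<^sub>m T"
proof -
  obtain R where "positive_resolvent (adjoint_op T \<circ>\<^sub>m T) R"
    using positive_resolvent_adjoint_comp[OF assms] by blast
  then obtain Q P where "resolvent_roots (adjoint_op T \<circ>\<^sub>m T) R Q P"
    using positive_resolvent.resolvent_roots_exist by blast
  then interpret resolvent_roots "adjoint_op T \<circ>\<^sub>m T" R Q P .
  show "selfadjoint_op (abs_op T)" "abs_op T \<circ>\<^sub>m abs_op T = adjoint_op T \<circ>\<^sub>m T"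
    using selfadjoint_root_op root_op_square by (simp_all add: abs_op_def sqrt_op_eq)
qed

subsection \<open>Minimum attainment\<close>

lemma adjoint_comp_inner:
  assumes "densely_defined T" "closed_op T"
    and "(adjoint_op T \<circ>\<^sub>m T) x = Some z" "T x = Some u" "T y = Some v"
  shows "inner v u = inner y z"
proof -
  have "linear_op T" using assms(2) by (simp add: closed_op_def)
  then obtain u' where "T x = Some u'" "\<forall>y v. T y = Some v \<longrightarrow> inner v u' = inner y z"
    using assms(1,3) by (auto simp: adjoint_comp_iff)
  with assms(4,5) show ?thesis by simp
qed

text \<open>That is, the domain of \<open>T\<^sup>* T\<close> is a core for \<open>T\<close>.\<close>

lemma graph_core:
  assumes dense: "densely_defined T" and cl: "closed_op T"
    and R: "positive_resolvent (adjoint_op T \<circ>\<^sub>m T) R"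
  shows "Map.graph T \<subseteq> closure (range (\<lambda>h. (R h, the (T (R h)))))"
proof -
  interpret positive_resolvent "adjoint_op T \<circ>\<^sub>m T" R by fact
  have lin: "linear_op T" and clg: "closed (Map.graph T)"
    using cl by (simp_all add: closed_op_def)
  define g where "g h = (R h, the (T (R h)))" for h
  have T_R: "T (R h) = Some (the (T (R h)))" for h
    using apply_resolvent[of h] by (auto simp: map_comp_Some_iff)
  have "range g \<subseteq> Map.graph T"
    using T_R by (auto simp: g_def graph_iff)
  then have sub: "closure (range g) \<subseteq> Map.graph T"
    using clg by (rule closure_minimal)
  have "linear g"
  proof (rule linearI)
    show "g (h + k) = g h + g k" for h k
      using linear_op_add[OF lin T_R T_R, of h k] by (simp add: g_def blinfun.bilinear_simps)
    show "g (c *\<^sub>R h) = c *\<^sub>R g h" for c h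
      using linear_op_scaleR[OF lin T_R, of c h] by (simp add: g_def blinfun.bilinear_simps)
  qed
  then have subs: "subspace (closure (range g))"
    by (intro subspace_closure linear_subspace_image subspace_UNIV)
  have "p \<in> closure (range g)" if p: "p \<in> Map.graph T" for p
  proof -
    obtain q where q: "q \<in> closure (range g)" "\<And>r. r \<in> closure (range g) \<Longrightarrow> inner (p - q) r = 0"
      using orthogonal_projection_exists[OF closed_closure subs] by blast
    obtain x u where xu: "p - q = (x, u)" by (cases "p - q")
    have "p - q \<in> Map.graph T"
      using p q(1) sub by (intro subspace_diff[OF subspace_graph[OF lin]]) auto
    then have T: "T x = Some u" by (simp add: xu graph_iff)
    \<comment> \<open>A graph point \<open>(x, u)\<close> orthogonal to all
      \<open>(R h, T (R h))\<close> satisfies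
      \<open>inner x (R h) + inner x (h - R h) = 0\<close>.\<close>
    have "inner x h = 0" for h
    proof -
      have "g h \<in> closure (range g)"
        by (intro closure_subset[THEN subsetD] rangeI)
      then have "inner x (R h) + inner u (the (T (R h))) = 0"
        using q(2)[of "g h"] by (simp add: xu g_def)
      moreover have "inner u (the (T (R h))) = inner x (h - R h)"
        using adjoint_comp_inner[OF dense cl apply_resolvent T_R T] .
      ultimately show ?thesis by (simp add: inner_simps)
    qed
    then have "x = 0" by (metis inner_eq_zero_iff)
    then have "p - q = 0" using T linear_op_zero[OF lin] by (simp add: xu zero_prod_def)
    with q(1) show ?thesis by simp
  qed
  then show ?thesis by (auto simp: g_def)
qed

text \<open>Homogeneity spreads the bound from the unit sphere to the whole domain; the infimum is
  over a set bounded below by \<open>0\<close> and nonempty once a minimizer exists.\<close>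

lemma min_attaining_iff:
  assumes lin: "linear_op T"
  shows "min_attaining T \<longleftrightarrow> (\<exists>x\<^sub>0 u\<^sub>0. T x\<^sub>0 = Some u\<^sub>0 \<and> norm x\<^sub>0 = 1 \<and>
    (\<forall>x u. T x = Some u \<longrightarrow> norm u\<^sub>0 * norm x \<le> norm u))" (is "_ \<longleftrightarrow> ?R")
proof -
  let ?M = "{norm (the (T x)) | x. x \<in> dom T \<and> norm x = 1}"
  have bdd: "bdd_below ?M"
    by (rule bdd_belowI[of _ 0]) auto
  show ?thesis
  proof
    assume "min_attaining T"
    then obtain x\<^sub>0 u\<^sub>0 where 0: "T x\<^sub>0 = Some u\<^sub>0" "norm x\<^sub>0 = 1" "norm u\<^sub>0 = Inf ?M"
      by (auto simp: min_attaining_def min_modulus_def)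
    have "norm u\<^sub>0 * norm x \<le> norm u" if x: "T x = Some u" for x u
    proof (cases "x = 0")
      case False
      define y where "y = (1 / norm x) *\<^sub>R x"
      have y: "T y = Some ((1 / norm x) *\<^sub>R u)" "norm y = 1"
        using linear_op_scaleR[OF lin x] False by (simp_all add: y_def)
      then have "norm ((1 / norm x) *\<^sub>R u) \<in> ?M"
        by (intro CollectI exI[of _ y]) auto
      then have "norm u\<^sub>0 \<le> norm ((1 / norm x) *\<^sub>R u)"
        unfolding 0(3) using bdd by (rule cInf_lower)
      with False show ?thesis by (simp add: field_simps)
    qed simp
    with 0 show ?R by blast
  next
    assume ?R
    then obtain x\<^sub>0 u\<^sub>0 where 0: "T x\<^sub>0 = Some u\<^sub>0" "norm x\<^sub>0 = 1"
      and le: "\<And>x u. T x = Some u \<Longrightarrow> norm u\<^sub>0 * norm x \<le> norm u"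
      by blast
    have mem: "norm u\<^sub>0 \<in> ?M"
      using 0 by (intro CollectI exI[of _ x\<^sub>0]) auto
    have "norm u\<^sub>0 \<le> r" if "r \<in> ?M" for r
      using that le by fastforce
    then have "Inf ?M = norm u\<^sub>0"
      using mem by (intro cInf_eq_minimum) auto
    with 0 show "min_attaining T"
      unfolding min_attaining_def min_modulus_def by (intro bexI[of _ x\<^sub>0]) auto
  qed
qed

text \<open>Stated for every closed densely defined operator, so that it also applies to |T|. At a
  minimizer the minimum of \<open>adjoint_op T \<circ>\<^sub>m T\<close> is the square of that of
  \<open>T\<close>.\<close>

lemma min_attaining_adjoint_comp:
  fixes T :: "'a::complex_hilbert \<rightharpoonup> 'b::complex_hilbert"
  assumes dense: "densely_defined T" and cl: "closed_op T"
  shows "min_attaining (adjoint_op T \<circ>\<^sub>m T) \<longleftrightarrow> min_attaining T"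
proof -
  define A where "A = adjoint_op T \<circ>\<^sub>m T"
  have lin: "linear_op T" using cl by (simp add: closed_op_def)
  have linA: "linear_op A"
    unfolding A_def by (intro linear_op_comp linear_op_adjoint lin dense)
  note A_iff = adjoint_comp_iff[OF lin dense, folded A_def]
  obtain R where R: "positive_resolvent A R"
    using positive_resolvent_adjoint_comp[OF assms] by (auto simp: A_def)
  interpret positive_resolvent A R by fact
  have A_form: "\<exists>u. T x = Some u \<and> (norm u)\<^sup>2 = inner x z" if "A x = Some z" for x z
  proof -
    obtain u where u: "T x = Some u" using \<open>A x = Some z\<close> unfolding A_iff by blast
    with that show ?thesis
      using adjoint_comp_inner[OF assms, folded A_def, of x z u x u] by (simp add: power2_norm_eq_inner)
  qed
  have "min_attaining A" if att: "min_attaining T"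
  proof -
    obtain x\<^sub>0 u\<^sub>0 where 0: "T x\<^sub>0 = Some u\<^sub>0" "norm x\<^sub>0 = 1"
      and le: "\<And>x u. T x = Some u \<Longrightarrow> norm u\<^sub>0 * norm x \<le> norm u"
      using att unfolding min_attaining_iff[OF lin] by blast
    define m where "m = norm u\<^sub>0"
    have "inner v u\<^sub>0 = inner y (m\<^sup>2 *\<^sub>R x\<^sub>0)" if v: "T y = Some v" for y v
    proof -
      \<comment> \<open>Minimality is tested at \<open>x\<^sub>0 + t *\<^sub>R y\<close>; the
        vanishing linear coefficient is the weak eigenvalue equation.\<close>
      have "0 \<le> 2 * t * (inner v u\<^sub>0 - inner y (m\<^sup>2 *\<^sub>R x\<^sub>0)) + t\<^sup>2 * ((norm v)\<^sup>2 - m\<^sup>2 * (norm y)\<^sup>2)" for t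
      proof -
        have "T (x\<^sub>0 + t *\<^sub>R y) = Some (u\<^sub>0 + t *\<^sub>R v)"
          by (intro linear_op_add[OF lin] linear_op_scaleR[OF lin] 0 v)
        from le[OF this] have "(m * norm (x\<^sub>0 + t *\<^sub>R y))\<^sup>2 \<le> (norm (u\<^sub>0 + t *\<^sub>R v))\<^sup>2"
          unfolding m_def by (intro power_mono) auto
        moreover have "(norm (x\<^sub>0 + t *\<^sub>R y))\<^sup>2 = 1 + 2 * t * inner y x\<^sub>0 + t\<^sup>2 * (norm y)\<^sup>2"
          using 0(2) norm_eq_1[of x\<^sub>0]
          by (simp add: power2_norm_eq_inner inner_simps inner_commute power2_eq_square[of t])
        moreover have "(norm (u\<^sub>0 + t *\<^sub>R v))\<^sup>2 = m\<^sup>2 + 2 * t * inner v u\<^sub>0 + t\<^sup>2 * (norm v)\<^sup>2"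
          by (simp add: m_def power2_norm_eq_inner inner_simps inner_commute power2_eq_square[of t])
        ultimately show ?thesis
          by (simp add: power_mult_distrib algebra_simps)
      qed
      then have "inner v u\<^sub>0 - inner y (m\<^sup>2 *\<^sub>R x\<^sub>0) = 0"
        by (rule linear_coeff_zero)
      then show ?thesis by simp
    qed
    then have "A x\<^sub>0 = Some (m\<^sup>2 *\<^sub>R x\<^sub>0)"
      unfolding A_iff using 0(1) by blast
    moreover have "m\<^sup>2 * norm x \<le> norm z" if xz: "A x = Some z" for x z
    proof (cases "x = 0")
      case False
      obtain u where u: "T x = Some u" "(norm u)\<^sup>2 = inner x z"
        using A_form[OF xz] by blast
      \<comment> \<open>The bound passes through \<open>inner x z\<close>, which Cauchy-Schwarz
        bounds by \<open>norm x * norm z\<close>; one factor \<open>norm x\<close> is then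
        cancelled.\<close>
      have "(m * norm x)\<^sup>2 \<le> (norm u)\<^sup>2"
        using le[OF u(1)] unfolding m_def by (intro power_mono) auto
      also have "\<dots> \<le> norm x * norm z"
        using norm_cauchy_schwarz u(2) by metis
      finally have "norm x * (m\<^sup>2 * norm x) \<le> norm x * norm z"
        by (simp add: power2_eq_square algebra_simps)
      with False show ?thesis by simp
    qed simp
    ultimately show ?thesis
      unfolding min_attaining_iff[OF linA] using 0(2)
      by (intro exI[of _ x\<^sub>0] exI[of _ "m\<^sup>2 *\<^sub>R x\<^sub>0"]) simp
  qed
  moreover have "min_attaining T" if att: "min_attaining A"
  proof -
    obtain x\<^sub>0 z\<^sub>0 where 0: "A x\<^sub>0 = Some z\<^sub>0" "norm x\<^sub>0 = 1"
      and le: "\<And>x z. A x = Some z \<Longrightarrow> norm z\<^sub>0 * norm x \<le> norm z"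
      using att unfolding min_attaining_iff[OF linA] by blast
    define \<mu> where "\<mu> = norm z\<^sub>0"
    have \<mu>_norm: "0 \<le> \<mu>" "norm z\<^sub>0 = \<mu> * norm x\<^sub>0"
      using 0(2) by (simp_all add: \<mu>_def)
    have eig: "z\<^sub>0 = \<mu> *\<^sub>R x\<^sub>0"
      by (rule minimum_eigenvector(1)[OF \<mu>_norm(1) _ 0(1) \<mu>_norm(2)]) (simp add: \<mu>_def le)
    have form: "\<mu> * (norm x)\<^sup>2 \<le> inner x z" if "A x = Some z" for x z
      by (rule minimum_eigenvector(2)[OF \<mu>_norm(1) _ 0(1) \<mu>_norm(2) that]) (simp add: \<mu>_def le)
    obtain u\<^sub>0 where u\<^sub>0: "T x\<^sub>0 = Some u\<^sub>0" "(norm u\<^sub>0)\<^sup>2 = inner x\<^sub>0 z\<^sub>0"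
      using A_form[OF 0(1)] by blast
    have "inner x\<^sub>0 x\<^sub>0 = 1" using 0(2) norm_eq_1 by blast
    then have \<mu>: "(norm u\<^sub>0)\<^sup>2 = \<mu>" by (simp add: u\<^sub>0(2) eig)
    have "norm u\<^sub>0 * norm x \<le> norm u" if xu: "T x = Some u" for x u
    proof -
      \<comment> \<open>The inequality defines a closed set of pairs, so it extends from the core to
        every point of the graph of \<open>T\<close>.\<close>
      let ?C = "{p. \<mu> * (norm (fst p))\<^sup>2 \<le> (norm (snd p :: 'b))\<^sup>2}"
      have "\<mu> * (norm (R h))\<^sup>2 \<le> (norm (the (T (R h))))\<^sup>2" for h
        using A_form[OF apply_resolvent, of h] form[OF apply_resolvent, of h] by fastforce
      then have "range (\<lambda>h. (R h, the (T (R h)))) \<subseteq> ?C" by auto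
      moreover have "closed ?C"
        by (intro closed_Collect_le continuous_intros)
      ultimately have "closure (range (\<lambda>h. (R h, the (T (R h))))) \<subseteq> ?C"
        by (rule closure_minimal)
      moreover have "(x, u) \<in> closure (range (\<lambda>h. (R h, the (T (R h)))))"
        by (rule graph_core[OF assms R[unfolded A_def], THEN subsetD]) (simp add: graph_iff xu)
      ultimately have "\<mu> * (norm x)\<^sup>2 \<le> (norm u)\<^sup>2" by auto
      then show ?thesis
        using power2_le_imp_le[of "norm u\<^sub>0 * norm x" "norm u"]
        by (simp add: power_mult_distrib \<mu>)
    qed
    with 0(2) u\<^sub>0(1) show ?thesis
      unfolding min_attaining_iff[OF lin] by blast
  qed
  ultimately show ?thesis by (auto simp: A_def)
qed

theorem theorem3p13:
  fixes T :: "'a::complex_hilbert \<rightharpoonup> 'b::complex_hilbert"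
  assumes "\<not> cfinite_dim TYPE('a)"
    and "\<not> cfinite_dim TYPE('b)"
    and "densely_defined T"
    and "closed_op T"
  shows "(min_attaining T \<longleftrightarrow> min_attaining (abs_op T)) \<and>
    (min_attaining (abs_op T) \<longleftrightarrow> min_attaining (adjoint_op T \<circ>\<^sub>m T))"
proof -
  define S where "S = abs_op T"
  have "selfadjoint_op S" and square: "S \<circ>\<^sub>m S = adjoint_op T \<circ>\<^sub>m T"
    using abs_op_properties[OF assms(3,4)] by (simp_all add: S_def)
  then have lin: "linear_op S" and dense: "densely_defined S" and adj: "adjoint_op S = S"
    by (simp_all add: selfadjoint_op_def)
  have cl: "closed_op S"
    using closed_op_adjoint[OF lin dense] by (simp add: adj)
  have "min_attaining (adjoint_op T \<circ>\<^sub>m T) \<longleftrightarrow> min_attaining T"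
    by (rule min_attaining_adjoint_comp[OF assms(3,4)])
  \<comment> \<open>Since \<open>S\<close> is its own adjoint, the same equivalence for
    \<open>S\<close> concerns \<open>S \<circ>\<^sub>m S\<close>, which is
    \<open>adjoint_op T \<circ>\<^sub>m T\<close>.\<close>
  moreover have "min_attaining (S \<circ>\<^sub>m S) \<longleftrightarrow> min_attaining S"
    using min_attaining_adjoint_comp[OF dense cl] by (simp add: adj)
  ultimately show ?thesis by (simp add: square flip: S_def)
qed

end
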